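(* Let $S\subset\mathbb{R}^2$ be a finite set of at least two distinct points in general position, all of which are vertices of the convex hull $CH(S)$, and let $m$ be the number of distinct vertices of $CH(S)$. Then there are at most $3m-4$ non-overlapping regions in the plane division associated with $FVB(S)$.
   Context: $\|\cdot\|$ is the Euclidean norm. $S=\{x_1,\dots,x_n\}$ is in general position if no four of its points are co-circular. $FV(x_i)=\{y\in\mathbb{R}^2:\|y-x_i\|>\|y-x_j\|\ \forall j\neq i\}$ is the farthest-point Voronoi cell of $x_i$. $FVB(S)$ is the boundary of the farthest-point Voronoi diagram, i.e. the set of points whose maximal distance to $S$ is attained by at least two points of $S$. The common boundary of two cells $FV(x_i)$ and $FV(x_j)$ is an edge $E(x_i,x_j)$ of $FVB(S)$. Intersections of edges are nodes. $\infty$ is a special node, counted once, which is the endpoint of every unbounded edge. $E^\circ$ denotes the edge $E$ without its endpoints. For a weight point $p\in\mathbb{R}^2$ that is not a vertex of $CH(S)$, let $\varphi(p)$ be the (unique) maximizer of $\|x-p\|/\max_k\|x-x_k\|$ over $x\in FVB(S)$ (including $x=\infty$, where the objective takes its limiting value $1$). The plane division associated with $FVB(S)$ is the division of the plane minus the vertices of $CH(S)$ into the non-empty regions among $\varphi^{-1}(O)$, for nodes $O$ of $FVB(S)$ (including $\infty$), and $\varphi^{-1}(E^\circ)$, for edges $E$ of $FVB(S)$. Here an edge whose interior contains the center of the minimum enclosing circle of $S$ counts as one single edge (it is not split at that center). *)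

theory Defs
  imports "HOL-Analysis.Analysis"
begin

type_synonym point = "real^2"

definition hull_vertices :: "point set \<Rightarrow> point set" where
  "hull_vertices S = {v. v extreme_point_of (convex hull S)}"

definition general_position :: "point set \<Rightarrow> bool" where
  "general_position S \<longleftrightarrow> (\<forall>T\<subseteq>S. card T = 4 \<longrightarrow> \<not> (\<exists>c r. T \<subseteq> sphere c r))"

definition max_dist :: "point set \<Rightarrow> point \<Rightarrow> real" where
  "max_dist S y = Max ((\<lambda>x. norm (y - x)) ` S)"

definition FV :: "point set \<Rightarrow> point \<Rightarrow> point set" where
  "FV S x = {y. \<forall>z\<in>S - {x}. norm (y - x) > norm (y - z)}"

definition FVB :: "point set \<Rightarrow> point set" where
  "FVB S = {y. \<exists>x\<in>S. \<exists>z\<in>S. x \<noteq> z \<and> norm (y - x) = max_dist S y \<and> norm (y - z) = max_dist S y}"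

text \<open>Pairs of cells without common boundary do not contribute an edge.\<close>

definition edges :: "point set \<Rightarrow> point set set" where
  "edges S = {frontier (FV S x) \<inter> frontier (FV S z) | x z. x \<in> S \<and> z \<in> S \<and> x \<noteq> z} - {{}}"

text \<open>An edge is a segment, a ray or a line, so its finite endpoints are its extreme points.\<close>

definition edge_interior :: "point set \<Rightarrow> point set" where
  "edge_interior E = E - {x. x extreme_point_of E}"

text \<open>
  The plane together with \<open>\<infinity>\<close> is represented by \<^typ>\<open>point option\<close>, with \<^term>\<open>None\<close> for \<open>\<infinity>\<close>.
\<close>

definition nodes :: "point set \<Rightarrow> point option set" where
  "nodes S = insert None (Some ` {y. \<exists>E\<in>edges S. \<exists>F\<in>edges S. E \<noteq> F \<and> y \<in> E \<inter> F})"

text \<open>The value at \<open>\<infinity>\<close> is the limit of the quotient as \<^term>\<open>norm x\<close> tends to infinity.\<close>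

fun objective :: "point set \<Rightarrow> point \<Rightarrow> point option \<Rightarrow> real" where
  "objective S p (Some x) = norm (x - p) / max_dist S x"
| "objective S p None = 1"

definition \<phi> :: "point set \<Rightarrow> point \<Rightarrow> point option" where
  "\<phi> S p = (THE w. is_arg_max (objective S p) (\<lambda>v. v \<in> insert None (Some ` FVB S)) w)"

definition \<phi>_preimage :: "point set \<Rightarrow> point option set \<Rightarrow> point set" where
  "\<phi>_preimage S Q = {p. p \<notin> hull_vertices S \<and> \<phi> S p \<in> Q}"

definition plane_division :: "point set \<Rightarrow> point set set" where
  "plane_division S =
     ({\<phi>_preimage S {v} | v. v \<in> nodes S} \<union>
      {\<phi>_preimage S (Some ` edge_interior E) | E. E \<in> edges S}) - {{}}"

end

theory Submission imports Defs begin

text \<open>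
  Preimages of disjoint sets under \<open>\<phi>\<close> are disjoint, whatever \<open>\<phi>\<close> is, so only nodes and edges have to
  be counted. No Euler formula is used; both counts come from minimising \<open>max_dist S\<close>, whose square is
  strictly convex. Let \<open>y\<^sub>0\<close> be its global minimum, the center of the minimum enclosing circle, and let
  \<open>k \<in> {2, 3}\<close> be the number of sites farthest from \<open>y\<^sub>0\<close>.

  At most one barycentric coordinate of a circumcenter is negative. Hence each node is the minimum over
  the closed cell of one of its three sites, and distinct nodes use distinct sites; nodes other than
  \<open>y\<^sub>0\<close> cannot use a site farthest from \<open>y\<^sub>0\<close>, so there are at most \<open>n - k\<close> of these. The minimum over an
  edge is attained at a node or at \<open>y\<^sub>0\<close>, and a node other than \<open>y\<^sub>0\<close> is the minimum for at most two of its
  three edges, because along the edge opposite to the obtuse angle the distance decreases. So there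
  are at most \<open>2 (n - k) + (k choose 2)\<close> edges, and adding everything up, \<open>\<infinity>\<close> included, gives \<open>3 n - 4\<close>.
\<close>

section \<open>Circumcenters in barycentric coordinates\<close>

text \<open>For sites \<open>x\<close> on a common circle about \<open>v\<close>, only the inner
  product varies, so comparing distances from \<open>y\<close> becomes comparing a linear functional
  with direction \<open>y - v\<close>.\<close>

lemma norm_diff_sq:
  fixes v y x :: "'a::real_inner"
  shows "(norm (y - x))\<^sup>2 = (norm (y - v))\<^sup>2 - 2 * ((y - v) \<bullet> (x - v)) + (norm (v - x))\<^sup>2"
  by (simp add: power2_norm_eq_inner algebra_simps inner_commute)

text \<open>Parallelogram law. The last term does not depend on \<open>x\<close>; it is the source
  of strict convexity below.\<close>

lemma norm_midpoint_sq:
  fixes v w x :: "'a::real_inner"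
  shows "(norm ((1/2) *\<^sub>R (v + w) - x))\<^sup>2 =
    (norm (v - x))\<^sup>2 / 2 + (norm (w - x))\<^sup>2 / 2 - (norm (v - w))\<^sup>2 / 4"
proof -
  have "(1/2) *\<^sub>R (v + w) - x = (1/2) *\<^sub>R ((v - x) + (w - x))"
    by (simp add: algebra_simps flip: scaleR_add_left)
  moreover have "v - w = (v - x) - (w - x)" by simp
  moreover have "(norm ((1/2) *\<^sub>R (p + q)))\<^sup>2 =
    (norm p)\<^sup>2 / 2 + (norm q)\<^sup>2 / 2 - (norm (p - q))\<^sup>2 / 4" for p q :: 'a
    by (simp add: power2_norm_eq_inner inner_simps inner_commute field_simps)
  ultimately show ?thesis by metis
qed

definition cross2 :: "point \<Rightarrow> point \<Rightarrow> real" where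
  "cross2 u v = u $ 1 * v $ 2 - u $ 2 * v $ 1"

text \<open>Cramer's rule in the plane: it supplies the barycentric coordinates of the origin, up to
  normalisation.\<close>

lemma cross2_cyclic: "cross2 b c *\<^sub>R a + cross2 c a *\<^sub>R b + cross2 a b *\<^sub>R c = 0"
  by (simp add: vec_eq_iff forall_2 cross2_def algebra_simps)

lemma cross2_eq_0_parallel:
  assumes "cross2 d e = 0" "d \<noteq> 0"
  obtains k where "e = k *\<^sub>R d"
proof (cases "d $ 1 = 0")
  case True
  with assms have "d $ 2 \<noteq> 0" by (auto simp: vec_eq_iff forall_2)
  with True assms have "e = (e $ 2 / d $ 2) *\<^sub>R d"
    by (auto simp: vec_eq_iff forall_2 cross2_def)
  then show ?thesis by (rule that)
next
  case False
  with assms have "e = (e $ 1 / d $ 1) *\<^sub>R d"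
    by (auto simp: vec_eq_iff forall_2 cross2_def field_simps)
  then show ?thesis by (rule that)
qed

text \<open>A line meets a circle at most twice. With \<open>c = a + k *\<^sub>R d\<close> and
  \<open>b = a + d\<close>, equality of the norms gives a quadratic whose only roots are 0 and 1, so
  \<open>c\<close> would be \<open>a\<close> or \<open>b\<close>.\<close>

lemma circle_not_collinear:
  fixes a b c :: point
  assumes "norm a = norm b" "norm a = norm c" "a \<noteq> b" "a \<noteq> c" "b \<noteq> c"
  shows "cross2 (b - a) (c - a) \<noteq> 0"
proof
  assume "cross2 (b - a) (c - a) = 0"
  then obtain k where k: "c - a = k *\<^sub>R (b - a)"
    using cross2_eq_0_parallel assms(3) by (metis right_minus_eq)
  define d where "d = b - a"
  have b: "b = a + d" and c: "c = a + k *\<^sub>R d" using k by (auto simp: d_def algebra_simps)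
  have "a \<bullet> a = b \<bullet> b" "a \<bullet> a = c \<bullet> c" using assms by (simp_all add: norm_eq)
  moreover have "b \<bullet> b = a \<bullet> a + (2 * (a \<bullet> d) + d \<bullet> d)"
    unfolding b by (simp add: inner_add_left inner_add_right inner_commute[of d a])
  moreover have "c \<bullet> c = a \<bullet> a + (2 * k * (a \<bullet> d) + k * k * (d \<bullet> d))"
    unfolding c by (simp add: inner_add_left inner_add_right inner_commute[of d a] mult.assoc distrib_left)
  ultimately have 1: "2 * (a \<bullet> d) + d \<bullet> d = 0" and 2: "2 * k * (a \<bullet> d) + k * k * (d \<bullet> d) = 0"
    by linarith+
  have "k * (k - 1) * (d \<bullet> d) = (2 * k * (a \<bullet> d) + k * k * (d \<bullet> d)) - k * (2 * (a \<bullet> d) + d \<bullet> d)"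
    by (simp add: algebra_simps)
  then have "k * (k - 1) * (d \<bullet> d) = 0" using 1 2 by simp
  then show False using assms b c by auto
qed

text \<open>The site \<open>c\<close> takes the only coordinate that may be negative, which happens
  when the angle at \<open>c\<close> is obtuse. Two negative coordinates would contradict the
  triangle inequality, since the third one would exceed the sum of their absolute values.\<close>

lemma circumcenter_coordinates:
  fixes T :: "point set"
  assumes "card T = 3" and sph: "\<And>x. x \<in> T \<Longrightarrow> norm (v - x) = r"
  shows "\<exists>c\<in>T. \<exists>w. sum w T = 1 \<and> (\<Sum>x\<in>T. w x *\<^sub>R (x - v)) = 0 \<and> (\<forall>x\<in>T - {c}. 0 \<le> w x)"
proof -
  obtain p q s where T: "T = {p, q, s}" and ds: "p \<noteq> q" "q \<noteq> s" "p \<noteq> s"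
    using assms(1) by (auto simp: card_3_iff)
  define D where "D = cross2 ((q - v) - (p - v)) ((s - v) - (p - v))"
  have "norm (p - v) = norm (q - v)" "norm (p - v) = norm (s - v)"
    using sph T by (auto simp: norm_minus_commute)
  then have D: "D \<noteq> 0" unfolding D_def by (intro circle_not_collinear) (use ds in auto)
  \<comment> \<open>Signed areas of the triangles that \<open>v\<close> forms with the opposite
    sides, relative to the area of the whole triangle.\<close>
  define w where "w x = (if x = p then cross2 (q - v) (s - v)
     else if x = q then cross2 (s - v) (p - v) else cross2 (p - v) (q - v)) / D" for x
  have w1: "sum w T = 1"
  proof -
    have "cross2 (q - v) (s - v) + cross2 (s - v) (p - v) + cross2 (p - v) (q - v) = D"
      unfolding D_def cross2_def by (simp add: algebra_simps)
    then have "w p + w q + w s = 1" using D ds by (simp add: w_def flip: add_divide_distrib)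
    then show ?thesis using ds by (simp add: T)
  qed
  have "(\<Sum>x\<in>T. w x *\<^sub>R (x - v)) = (1/D) *\<^sub>R (cross2 (q - v) (s - v) *\<^sub>R (p - v)
      + cross2 (s - v) (p - v) *\<^sub>R (q - v) + cross2 (p - v) (q - v) *\<^sub>R (s - v))"
    using ds by (simp add: T w_def scaleR_add_right add.assoc)
  then have w0: "(\<Sum>x\<in>T. w x *\<^sub>R (x - v)) = 0" by (simp only: cross2_cyclic scaleR_zero_right)
  have r: "0 < r"
    using ds sph T by (metis insertCI norm_eq_zero norm_ge_zero order_le_less right_minus_eq)
  have two_neg: False if T: "T = {x, y, z}" "x \<noteq> y" "y \<noteq> z" "x \<noteq> z" and neg: "w x < 0" "w y < 0" for x y z
  proof -
    have "w z *\<^sub>R (z - v) = (- w x) *\<^sub>R (x - v) + (- w y) *\<^sub>R (y - v)"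
      using w0 that by (simp add: T add_eq_0_iff algebra_simps)
    moreover have "norm ((- w x) *\<^sub>R (x - v) + (- w y) *\<^sub>R (y - v)) \<le> (- w x) * r + (- w y) * r"
      by (rule norm_triangle_le) (use that sph[of x] sph[of y] in \<open>simp add: norm_minus_commute\<close>)
    moreover have "norm (w z *\<^sub>R (z - v)) = \<bar>w z\<bar> * r"
      using that sph[of z] by (simp add: norm_minus_commute)
    ultimately have "\<bar>w z\<bar> * r \<le> (- w x) * r + (- w y) * r" by metis
    then have "\<bar>w z\<bar> * r \<le> (- w x - w y) * r" by (simp add: algebra_simps)
    then have "\<bar>w z\<bar> \<le> - w x - w y" using r by simp
    moreover have "w x + w y + w z = 1" using w1 that by (simp add: add.assoc)
    ultimately show False by linarith
  qed
  have "\<exists>c\<in>T. \<forall>x\<in>T - {c}. 0 \<le> w x"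
    using two_neg[of p q s] two_neg[of q s p] two_neg[of p s q] ds
    by (cases "w p < 0"; cases "w q < 0"; cases "w s < 0") (auto simp: T insert_commute)
  then show ?thesis using w1 w0 by blast
qed

text \<open>The weighted sum of the differences to the value at \<open>c\<close> is nonnegative, and
  the term of \<open>c\<close> itself is zero. So the sign of \<open>w c\<close> does not
  matter.\<close>

lemma weighted_inner_le_0:
  fixes T :: "'a::real_inner set"
  assumes "finite T" "c \<in> T" "sum w T = 1" "(\<Sum>x\<in>T. w x *\<^sub>R (x - v)) = 0"
    and "\<And>x. x \<in> T - {c} \<Longrightarrow> 0 \<le> w x"
    and "\<And>x. x \<in> T \<Longrightarrow> q \<bullet> (c - v) \<le> q \<bullet> (x - v)"
  shows "q \<bullet> (c - v) \<le> 0"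
proof -
  have "0 \<le> (\<Sum>x\<in>T. w x * (q \<bullet> (x - v) - q \<bullet> (c - v)))"
    using assms by (intro sum_nonneg) (metis Diff_iff diff_ge_0_iff_ge diff_self mult_nonneg_nonneg mult_zero_right order_refl singletonD)
  also have "\<dots> = q \<bullet> (\<Sum>x\<in>T. w x *\<^sub>R (x - v)) - sum w T * (q \<bullet> (c - v))"
    by (simp add: inner_sum_right right_diff_distrib sum_subtractf sum_distrib_right)
  finally show ?thesis using assms by simp
qed

section \<open>Farthest sites and constrained minima of the maximal distance\<close>

definition farthest :: "point set \<Rightarrow> point \<Rightarrow> point set" where
  "farthest S y = {x \<in> S. norm (y - x) = max_dist S y}"

text \<open>Candidates for the finite nodes, described without edges; \<open>edges_meet\<close>
  makes the connection.\<close>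

definition triple_points :: "point set \<Rightarrow> point set" where
  "triple_points S = {v. card (farthest S v) = 3}"

definition adjacent_pairs :: "point set \<Rightarrow> point set set" where
  "adjacent_pairs S = {e. card e = 2 \<and> (\<exists>y. e \<subseteq> farthest S y)}"

text \<open>The size of \<open>e\<close> selects the domain of minimisation: the whole plane for no
  site, a closed cell for one, the common part of two closed cells for two.\<close>

abbreviation lowest :: "point set \<Rightarrow> point set \<Rightarrow> point \<Rightarrow> bool" where
  "lowest S e v \<equiv> is_arg_min (max_dist S) (\<lambda>y. e \<subseteq> farthest S y) v"

locale planar_sites =
  fixes S :: "point set"
  assumes fin: "finite S" and card_ge: "2 \<le> card S" and gp: "general_position S"
begin

lemma nonempty: "S \<noteq> {}"
  using card_ge by auto

lemma norm_le_max_dist: "s \<in> S \<Longrightarrow> norm (y - s) \<le> max_dist S y"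
  unfolding max_dist_def using fin by (intro Max_ge) auto

lemma farthest_nonempty: "farthest S y \<noteq> {}"
proof -
  have "max_dist S y \<in> (\<lambda>x. norm (y - x)) ` S"
    unfolding max_dist_def using fin nonempty by (intro Max_in) auto
  then show ?thesis by (auto simp: farthest_def)
qed

lemma farthest_subset: "farthest S y \<subseteq> S" and finite_farthest: "finite (farthest S y)"
  using fin by (auto simp: farthest_def)

lemma farthestD: "x \<in> farthest S y \<Longrightarrow> norm (y - x) = max_dist S y"
  by (simp add: farthest_def)

lemma farthest_iff: "x \<in> farthest S y \<longleftrightarrow> x \<in> S \<and> (\<forall>s\<in>S. norm (y - s) \<le> norm (y - x))"
proof -
  obtain a where "a \<in> S" "norm (y - a) = max_dist S y"
    using farthest_nonempty by (auto simp: farthest_def)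
  then show ?thesis
    unfolding farthest_def using norm_le_max_dist order_antisym by (metis (mono_tags, lifting) mem_Collect_eq)
qed

lemma max_dist_nonneg: "0 \<le> max_dist S y"
  using farthest_nonempty[of y] by (auto simp: farthest_def) (metis norm_ge_zero)

lemma card_farthest_le: "card (farthest S y) \<le> 3"
proof (rule ccontr)
  assume "\<not> ?thesis"
  then obtain T where "T \<subseteq> farthest S y" "card T = 4"
    by (metis not_less_eq_eq numeral_3_eq_3 obtain_subset_with_card_n eval_nat_numeral(2) semiring_norm(26,27))
  moreover from this have "T \<subseteq> sphere y (max_dist S y)" by (auto simp: farthest_def dist_norm)
  ultimately show False using gp farthest_subset unfolding general_position_def by blast
qed

lemma continuous_on_max_dist: "continuous_on X (max_dist S)"
proof -
  have "\<bar>max_dist S y - max_dist S z\<bar> \<le> dist y z" for y z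
  proof -
    have "max_dist S y \<le> max_dist S z + dist y z" for y z
    proof -
      obtain a where a: "a \<in> S" "norm (y - a) = max_dist S y"
        using farthest_nonempty by (auto simp: farthest_def)
      have "norm (y - a) \<le> dist y z + norm (z - a)"
        by (metis dist_norm dist_triangle)
      then show ?thesis using a norm_le_max_dist[of a z] by simp
    qed
    from this[of y z] this[of z y] show ?thesis by (simp add: dist_commute abs_le_iff)
  qed
  then have "1-lipschitz_on X (max_dist S)"
    by (intro lipschitz_onI) (auto simp: dist_real_def)
  then show ?thesis by (rule lipschitz_on_continuous_on)
qed

text \<open>The feasible set is closed, and outside a ball about any site, with radius the value at
  \<open>z\<close>, the maximal distance exceeds that value. So compactness applies.\<close>

lemma lowest_exists:
  assumes "e \<subseteq> farthest S z"
  obtains v where "lowest S e v"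
proof -
  obtain x0 where x0: "x0 \<in> S" using nonempty by auto
  define C where "C = {y. e \<subseteq> farthest S y}"
  have "C = (\<Inter>x\<in>e. \<Inter>s\<in>S. {y. norm (y - s) \<le> norm (y - x)})"
    using assms farthest_subset[of z] unfolding C_def by (auto simp: farthest_iff subset_iff)
  then have "closed C" by (auto intro!: closed_INT closed_Collect_le continuous_intros)
  then have "compact (C \<inter> cball x0 (max_dist S z))" by (intro closed_Int_compact) auto
  moreover have zC: "z \<in> C \<inter> cball x0 (max_dist S z)"
    using assms norm_le_max_dist[OF x0, of z] by (auto simp: C_def dist_norm norm_minus_commute)
  ultimately obtain v where v: "v \<in> C \<inter> cball x0 (max_dist S z)"
    "\<forall>y\<in>C \<inter> cball x0 (max_dist S z). max_dist S v \<le> max_dist S y"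
    using continuous_attains_inf[OF _ _ continuous_on_max_dist] by (metis empty_iff)
  have "max_dist S v \<le> max_dist S y" if "y \<in> C" for y
  proof (cases "y \<in> cball x0 (max_dist S z)")
    case False
    then show ?thesis
      using bspec[OF v(2) zC] norm_le_max_dist[OF x0, of y] by (simp add: dist_norm norm_minus_commute)
  qed (use v that in auto)
  then show ?thesis using v that by (auto simp: is_arg_min_linorder C_def)
qed

text \<open>The midpoint of two minimisers is feasible, because inequalities between squared
  distances to two sites survive averaging. By the parallelogram law its value would be strictly
  smaller.\<close>

lemma lowest_unique:
  assumes "lowest S e v" "lowest S e w"
  shows "v = w"
proof (rule ccontr)
  assume "v \<noteq> w"
  define m where "m = (1/2) *\<^sub>R (v + w)"
  define R where "R = max_dist S v"
  have R: "max_dist S w = R" using assms by (auto simp: is_arg_min_linorder R_def intro: antisym)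
  have msq: "(norm (m - s))\<^sup>2 = (norm (v - s))\<^sup>2 / 2 + (norm (w - s))\<^sup>2 / 2 - (norm (v - w))\<^sup>2 / 4" for s
    unfolding m_def by (rule norm_midpoint_sq)
  have "e \<subseteq> farthest S m"
  proof
    fix x assume "x \<in> e"
    then have x: "x \<in> farthest S v" "x \<in> farthest S w" using assms by (auto simp: is_arg_min_linorder)
    have "norm (m - s) \<le> norm (m - x)" if "s \<in> S" for s
    proof -
      have "(norm (v - s))\<^sup>2 \<le> (norm (v - x))\<^sup>2" "(norm (w - s))\<^sup>2 \<le> (norm (w - x))\<^sup>2"
        using x that by (auto simp: farthest_iff power_mono)
      then have "(norm (m - s))\<^sup>2 \<le> (norm (m - x))\<^sup>2" unfolding msq by linarith
      then show ?thesis by (simp add: power2_le_iff_abs_le)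
    qed
    then show "x \<in> farthest S m" using x by (auto simp: farthest_iff)
  qed
  then have "R \<le> max_dist S m" using assms by (auto simp: is_arg_min_linorder R_def)
  moreover obtain s where s: "s \<in> S" "norm (m - s) = max_dist S m"
    using farthest_nonempty by (auto simp: farthest_def)
  ultimately have "R\<^sup>2 \<le> (norm (m - s))\<^sup>2" by (simp add: R_def max_dist_nonneg power_mono)
  moreover have "(norm (v - s))\<^sup>2 \<le> R\<^sup>2" "(norm (w - s))\<^sup>2 \<le> R\<^sup>2"
    using norm_le_max_dist[OF s(1), of v] norm_le_max_dist[OF s(1), of w] R
    by (auto simp: R_def power_mono)
  moreover have "(norm (v - w))\<^sup>2 > 0" using \<open>v \<noteq> w\<close> by simp
  ultimately show False using msq[of s] by linarith
qed

section \<open>Descent directions and the center of the minimum enclosing circle\<close>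

text \<open>Finitely many strict inequalities survive a small move. The bound \<open>t < 1\<close>
  later makes the factor \<open>1 - t\<close> positive.\<close>

lemma farthest_perturb:
  obtains t where "0 < t" "t < 1" "farthest S (v + t *\<^sub>R u) \<subseteq> farthest S v"
proof -
  obtain a where a: "a \<in> farthest S v" using farthest_nonempty by blast
  have "\<forall>\<^sub>F t in at_right (0::real). norm (v + t *\<^sub>R u - s) < norm (v + t *\<^sub>R u - a)"
    if "s \<in> S - farthest S v" for s
  proof -
    have "norm (v - s) < norm (v - a)"
      using that a norm_le_max_dist[of s v] by (auto simp: farthest_def)
    moreover have "((\<lambda>t. norm (v + t *\<^sub>R u - a) - norm (v + t *\<^sub>R u - s)) \<longlongrightarrow>
        norm (v + 0 *\<^sub>R u - a) - norm (v + 0 *\<^sub>R u - s)) (at_right (0::real))"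
      by (intro tendsto_intros)
    ultimately show ?thesis
      using order_tendstoD(1)[of _ _ _ 0] by fastforce
  qed
  then have "\<forall>\<^sub>F t in at_right (0::real). \<forall>s\<in>S - farthest S v. norm (v + t *\<^sub>R u - s) < norm (v + t *\<^sub>R u - a)"
    using fin by (intro eventually_ball_finite) auto
  moreover have "\<forall>\<^sub>F t in at_right (0::real). t \<in> {0<..<1}"
    by (rule eventually_at_right_real) simp
  ultimately have "\<forall>\<^sub>F t in at_right (0::real). t \<in> {0<..<1} \<and>
      (\<forall>s\<in>S - farthest S v. norm (v + t *\<^sub>R u - s) < norm (v + t *\<^sub>R u - a))"
    by (simp add: eventually_conj_iff)
  then obtain t where t: "t \<in> {0<..<1}"
      "\<forall>s\<in>S - farthest S v. norm (v + t *\<^sub>R u - s) < norm (v + t *\<^sub>R u - a)"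
    using eventually_happens'[OF trivial_limit_at_right_real] by blast
  have "farthest S (v + t *\<^sub>R u) \<subseteq> farthest S v"
  proof
    fix s assume "s \<in> farthest S (v + t *\<^sub>R u)"
    moreover have "a \<in> S" using a farthest_subset by blast
    ultimately have "s \<in> S" "\<not> norm (v + t *\<^sub>R u - s) < norm (v + t *\<^sub>R u - a)"
      by (auto simp: farthest_iff not_less)
    then show "s \<in> farthest S v" using t(2) by blast
  qed
  with t(1) show ?thesis by (intro that) auto
qed

text \<open>Otherwise moving from \<open>v\<close> a little towards the midpoint of \<open>a\<close> and \<open>b\<close> keeps both farthest and
  lowers the maximal distance. The case \<open>a = b\<close> is allowed.\<close>

lemma lowest_slide:
  assumes low: "lowest S {a, b} v"
    and up: "\<And>s. s \<in> farthest S v \<Longrightarrow> ((a - v) + (b - v)) \<bullet> (a - v) \<le> ((a - v) + (b - v)) \<bullet> (s - v)"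
  shows "(a - v) + (b - v) = 0"
proof -
  define u where "u = (a - v) + (b - v)"
  define R where "R = max_dist S v"
  have ab: "a \<in> farthest S v" "b \<in> farthest S v" using low by (auto simp: is_arg_min_linorder)
  have R: "norm (v - s) = R" if "s \<in> farthest S v" for s using farthestD[OF that] by (simp add: R_def)
  have "norm (a - v) = norm (b - v)" using R ab by (metis norm_minus_commute)
  then have uab: "u \<bullet> (a - v) = u \<bullet> (b - v)"
    unfolding u_def inner_add_left by (simp add: norm_eq inner_commute)
  then have ua: "u \<bullet> u = 2 * (u \<bullet> (a - v))"
    by (metis u_def inner_add_right mult_2)
  obtain t where t: "0 < t" "t < 1" and sub: "farthest S (v + t *\<^sub>R u) \<subseteq> farthest S v"
    by (rule farthest_perturb)
  define y where "y = v + t *\<^sub>R u"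
  have sq: "(norm (y - s))\<^sup>2 = t\<^sup>2 * (u \<bullet> u) - 2 * t * (u \<bullet> (s - v)) + R\<^sup>2" if "s \<in> farthest S v" for s
    using norm_diff_sq[of y s v] R[OF that]
    by (simp add: y_def power_mult_distrib dot_square_norm)
  obtain s where s: "s \<in> farthest S y" using farthest_nonempty by blast
  with sub have sv: "s \<in> farthest S v" by (auto simp: y_def)
  \<comment> \<open>Among the sites farthest from \<open>v\<close>, those with the least inner
    product with \<open>u\<close> recede most from the moving point.\<close>
  have top: "x \<in> farthest S y" if "x \<in> farthest S v" "u \<bullet> (x - v) = u \<bullet> (a - v)" for x
  proof -
    have "t * (u \<bullet> (x - v)) \<le> t * (u \<bullet> (s - v))"
      using up[OF sv] that t by (intro mult_left_mono) (auto simp: u_def)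
    then have "(norm (y - s))\<^sup>2 \<le> (norm (y - x))\<^sup>2" by (simp add: sq sv that)
    then have "norm (y - s) \<le> norm (y - x)" by (simp add: power2_le_iff_abs_le)
    then show ?thesis using s that(1) by (auto simp: farthest_iff intro: order_trans)
  qed
  have ay: "a \<in> farthest S y" "b \<in> farthest S y" using top ab uab by auto
  then have "R \<le> norm (y - a)"
    using low farthestD[of a y] by (auto simp: is_arg_min_linorder R_def)
  then have "R\<^sup>2 \<le> (norm (y - a))\<^sup>2" by (simp add: R_def max_dist_nonneg power_mono)
  \<comment> \<open>The move changes the squared distance to \<open>a\<close> by
    \<open>t\<^sup>2 - t\<close> times \<open>u \<bullet> u\<close>, which is negative unless
    \<open>u = 0\<close>.\<close>
  then have "t * (u \<bullet> u) \<le> t * (t * (u \<bullet> u))"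
    unfolding sq[OF ab(1)] ua by (simp add: power2_eq_square mult_ac)
  then have "(1 - t) * (u \<bullet> u) \<le> 0" using t by (simp add: algebra_simps)
  then have "u \<bullet> u \<le> 0" using t by (simp add: mult_le_0_iff)
  then show ?thesis using inner_gt_zero_iff[of u] by (auto simp: u_def not_less[symmetric])
qed

text \<open>The empty set of sites imposes no constraint, so this is the global minimum.\<close>

definition center :: point where
  "center = (THE v. lowest S {} v)"

lemma lowest_center: "lowest S {} center"
proof -
  obtain v where "lowest S {} v" by (rule lowest_exists[of "{}"]) auto
  then show ?thesis unfolding center_def using lowest_unique theI[of "lowest S {}"] by blast
qed

lemma eq_center: "(\<And>y. max_dist S v \<le> max_dist S y) \<Longrightarrow> v = center"
  by (rule lowest_unique[OF _ lowest_center]) (simp add: is_arg_min_linorder)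

lemma lowest_center_of: "e \<subseteq> farthest S center \<Longrightarrow> lowest S e center"
  using lowest_center by (simp add: is_arg_min_linorder)

text \<open>If \<open>a\<close> were the only farthest site, sliding towards it would force
  \<open>a = center\<close>, hence radius 0 and a single site.\<close>

lemma card_farthest_center: "2 \<le> card (farthest S center)"
proof (rule ccontr)
  assume "\<not> ?thesis"
  moreover have "card (farthest S center) \<noteq> 0" using farthest_nonempty finite_farthest by simp
  ultimately have "card (farthest S center) = 1" by linarith
  then obtain a where a: "farthest S center = {a}" by (auto simp: card_1_singleton_iff)
  have "(a - center) + (a - center) = 0"
    by (rule lowest_slide) (use a lowest_center_of[of "{a}"] in auto)
  then have "a = center" by (simp flip: scaleR_2)
  then have "max_dist S center = 0" using farthestD[of a center] a by simp
  then have "S \<subseteq> {center}" using norm_le_max_dist[of _ center] by fastforce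
  then have "card S \<le> 1" using card_mono[of "{center}" S] by simp
  then show False using card_ge by simp
qed

section \<open>Minima over cells and edges\<close>

text \<open>If only \<open>a\<close> and \<open>b\<close> are farthest from \<open>v\<close>,
  sliding shows that \<open>v\<close> is their midpoint. Every point is at least half their distance
  away from one of them, so \<open>v\<close> is the global minimum.\<close>

lemma lowest_pair:
  assumes low: "lowest S e v" and "card e = 2"
  shows "v = center \<or> v \<in> triple_points S"
proof (rule disjCI)
  assume "v \<notin> triple_points S"
  moreover have sub: "e \<subseteq> farthest S v" using low by (simp add: is_arg_min_linorder)
  ultimately have "card (farthest S v) = 2"
    using card_farthest_le[of v] card_mono[OF finite_farthest sub] assms(2)
    by (auto simp: triple_points_def)
  then have far: "farthest S v = e" using card_subset_eq[OF finite_farthest sub] assms(2) by simp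
  obtain a b where e: "e = {a, b}" using assms(2) by (auto simp: card_2_iff)
  have nab: "norm (a - v) = norm (b - v)"
    using far e farthestD by (metis insertCI norm_minus_commute)
  have "((a - v) + (b - v)) \<bullet> (a - v) = ((a - v) + (b - v)) \<bullet> (b - v)"
    using nab unfolding inner_add_left by (simp add: norm_eq inner_commute)
  then have "(a - v) + (b - v) = 0"
    using low far e by (intro lowest_slide) auto
  then have "a - b = (- 2) *\<^sub>R (v - a)" by (simp add: algebra_simps scaleR_2)
  then have d: "norm (a - b) = 2 * norm (v - a)" by simp
  show "v = center"
  proof (rule eq_center)
    fix y
    have ab: "a \<in> S" "b \<in> S" using far e farthest_subset[of v] by auto
    have "norm (a - b) \<le> norm (y - a) + norm (y - b)"
      by (metis dist_norm dist_triangle3)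
    moreover have "norm (v - a) = max_dist S v" using far e by (intro farthestD) auto
    ultimately show "max_dist S v \<le> max_dist S y"
      using d norm_le_max_dist[OF ab(1), of y] norm_le_max_dist[OF ab(2), of y] by linarith
  qed
qed

text \<open>Take for \<open>c\<close> the site whose coordinate may be negative. When
  \<open>c\<close> is farthest from \<open>y\<close>, \<open>c\<close> minimises the inner product
  with \<open>y - v\<close> over the triple, so this product with \<open>c - v\<close> is at most 0
  and \<open>y\<close> is no closer to \<open>c\<close> than \<open>v\<close> is.\<close>

lemma triple_point_lowest:
  assumes "v \<in> triple_points S"
  obtains c where "lowest S {c} v"
proof -
  define T where "T = farthest S v"
  define R where "R = max_dist S v"
  have T3: "card T = 3" and R: "\<And>x. x \<in> T \<Longrightarrow> norm (v - x) = R"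
    using assms by (auto simp: triple_points_def T_def R_def farthest_def)
  obtain c w where wc: "c \<in> T" "sum w T = 1" "(\<Sum>x\<in>T. w x *\<^sub>R (x - v)) = 0"
    "\<And>x. x \<in> T - {c} \<Longrightarrow> 0 \<le> w x"
    using circumcenter_coordinates[OF T3 R] by blast
  have "R \<le> max_dist S y" if c: "c \<in> farthest S y" for y
  proof -
    have "(y - v) \<bullet> (c - v) \<le> 0"
    proof (rule weighted_inner_le_0[OF _ wc])
      fix x assume x: "x \<in> T"
      then have "(norm (y - x))\<^sup>2 \<le> (norm (y - c))\<^sup>2"
        using c by (auto simp: farthest_iff T_def intro!: power_mono)
      then show "(y - v) \<bullet> (c - v) \<le> (y - v) \<bullet> (x - v)"
        using norm_diff_sq[of y x v] norm_diff_sq[of y c v] R[OF x] R[OF wc(1)] by simp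
    qed (auto simp: T_def finite_farthest)
    then have "R\<^sup>2 \<le> (norm (y - c))\<^sup>2"
      using norm_diff_sq[of y c v] zero_le_power2[of "norm (y - v)"] unfolding R[OF wc(1)] by linarith
    then show ?thesis using farthestD[OF c] max_dist_nonneg[of y] by (simp add: power2_le_iff_abs_le)
  qed
  then have "lowest S {c} v" using wc(1) by (auto simp: is_arg_min_linorder T_def R_def)
  then show ?thesis by (rule that)
qed

text \<open>Without a negative coordinate, \<open>v\<close> lies in the hull of its farthest sites
  and is the center. Otherwise the failing pair is the one opposite to the site \<open>c\<close>
  with negative coordinate.\<close>

lemma triple_point_pair_not_lowest:
  assumes "v \<in> triple_points S" "v \<noteq> center"
  shows "\<exists>e. e \<subseteq> farthest S v \<and> card e = 2 \<and> \<not> lowest S e v"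
proof (rule ccontr)
  assume "\<not> ?thesis"
  then have low: "lowest S e v" if "e \<subseteq> farthest S v" "card e = 2" for e using that by blast
  define T where "T = farthest S v"
  define R where "R = max_dist S v"
  have T3: "card T = 3" and R: "\<And>x. x \<in> T \<Longrightarrow> norm (v - x) = R" and TS: "T \<subseteq> S"
    using assms by (auto simp: triple_points_def T_def R_def farthest_def)
  have finT: "finite T" by (simp add: T_def finite_farthest)
  obtain c w where wc: "c \<in> T" "sum w T = 1" "(\<Sum>x\<in>T. w x *\<^sub>R (x - v)) = 0"
    "\<And>x. x \<in> T - {c} \<Longrightarrow> 0 \<le> w x"
    using circumcenter_coordinates[OF T3 R] by blast
  show False
  proof (cases "0 \<le> w c")
    case True
    have "v = center"
    proof (rule eq_center)
      fix y
      \<comment> \<open>With all weights nonnegative, the minimising site may be any of the three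
        and can depend on \<open>y\<close>.\<close>
      obtain d where d: "d \<in> T" "\<And>x. x \<in> T \<Longrightarrow> (y - v) \<bullet> (d - v) \<le> (y - v) \<bullet> (x - v)"
        using finT wc(1) ex_is_arg_min_if_finite[of T "\<lambda>x. (y - v) \<bullet> (x - v)"]
        by (auto simp: is_arg_min_linorder)
      have "(y - v) \<bullet> (d - v) \<le> 0"
        by (rule weighted_inner_le_0[OF finT d(1) wc(2,3) _ d(2)]) (use True wc(4) in blast)+
      then have "R\<^sup>2 \<le> (norm (y - d))\<^sup>2"
        using norm_diff_sq[of y d v] zero_le_power2[of "norm (y - v)"] unfolding R[OF d(1)] by linarith
      then have "R \<le> norm (y - d)" by (simp add: power2_le_iff_abs_le)
      then show "max_dist S v \<le> max_dist S y"
        using norm_le_max_dist[of d y] d(1) TS by (auto simp: R_def)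
    qed
    then show False using assms by simp
  next
    case False
    have "card (T - {c}) = 2" using T3 wc(1) finT by simp
    then obtain a b where Tc: "T - {c} = {a, b}" and ab: "a \<noteq> b" by (auto simp: card_2_iff)
    have T: "T = {a, b, c}" and ac: "a \<noteq> c" and bc: "b \<noteq> c" using Tc wc(1) by auto
    define u where "u = (a - v) + (b - v)"
    have na: "norm (a - v) = R" and nb: "norm (b - v) = R" and nc: "norm (c - v) = R"
      using R T by (auto simp: norm_minus_commute)
    have uab: "u \<bullet> (a - v) = u \<bullet> (b - v)"
      using na nb norm_eq[of "a - v" "b - v"] inner_commute[of "a - v" "b - v"]
      unfolding u_def inner_add_left by linarith
    have "u \<bullet> u = 2 * (u \<bullet> (a - v))"
      using uab by (metis u_def inner_add_right mult_2)
    then have ua: "0 \<le> u \<bullet> (a - v)" using inner_ge_zero[of u] by linarith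
    have ws: "w a + w b + w c = 1" using wc(2) ab ac bc by (simp add: T add.assoc)
    have w0: "w a *\<^sub>R (a - v) + w b *\<^sub>R (b - v) + w c *\<^sub>R (c - v) = 0"
      using wc(3) ab ac bc by (simp add: T add.assoc)
    then have "u \<bullet> (w a *\<^sub>R (a - v) + w b *\<^sub>R (b - v) + w c *\<^sub>R (c - v)) = u \<bullet> 0"
      by (rule arg_cong)
    then have "w a * (u \<bullet> (a - v)) + w b * (u \<bullet> (b - v)) + w c * (u \<bullet> (c - v)) = 0"
      unfolding inner_add_right inner_scaleR_right inner_zero_right .
    moreover have "w b = 1 - w c - w a" using ws by linarith
    \<comment> \<open>The functional given by \<open>u\<close> takes the same nonnegative value on
      \<open>a - v\<close> and \<open>b - v\<close>. Since \<open>w c\<close> is negative, its value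
      on \<open>c - v\<close> is at least as large, which is what \<open>lowest_slide\<close>
      requires.\<close>
    ultimately have "(1 - w c) * (u \<bullet> (a - v)) + w c * (u \<bullet> (c - v)) = 0"
      unfolding uab[symmetric] by (simp add: left_diff_distrib)
    then have "(- w c) * (u \<bullet> (a - v)) \<le> (- w c) * (u \<bullet> (c - v))"
      using ua by (simp add: algebra_simps)
    then have uc: "u \<bullet> (a - v) \<le> u \<bullet> (c - v)" using False by simp
    have "lowest S {a, b} v" using low[of "{a, b}"] T ab by (auto simp: T_def)
    then have u0: "(a - v) + (b - v) = 0"
      by (rule lowest_slide) (use uab uc T in \<open>auto simp: T_def u_def\<close>)
    then have bv: "b - v = - (a - v)" by (metis minus_unique)
    \<comment> \<open>Now \<open>a\<close> and \<open>b\<close> are antipodal about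
      \<open>v\<close>, so \<open>c\<close> lies on the line through them and, being on the circle,
      is one of them.\<close>
    have "w c *\<^sub>R (c - v) = (w b - w a) *\<^sub>R (a - v)"
      using w0 unfolding bv by (simp add: algebra_simps add_eq_0_iff)
    then have "inverse (w c) *\<^sub>R w c *\<^sub>R (c - v) = inverse (w c) *\<^sub>R (w b - w a) *\<^sub>R (a - v)"
      by (rule arg_cong)
    then have "c - v = (inverse (w c) * (w b - w a)) *\<^sub>R (a - v)" using False by simp
    then obtain k where k: "c - v = k *\<^sub>R (a - v)" by blast
    have "R \<noteq> 0" using na nb ab by auto
    then have "\<bar>k\<bar> = 1" using k na nc by (metis norm_scaleR mult_cancel_right1)
    then have "k = 1 \<or> k = - 1" by linarith
    then have "c - v = a - v \<or> c - v = b - v" using k bv by auto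
    then show False using ac bc by auto
  qed
qed

section \<open>Counting triple points and adjacent pairs\<close>

lemma card_triple_points:
  "finite (triple_points S)"
  "card (triple_points S - {center}) + card (farthest S center) \<le> card S"
proof -
  let ?V = "triple_points S - {center}"
  have "\<forall>v\<in>?V. \<exists>c. lowest S {c} v" using triple_point_lowest by (metis Diff_iff)
  then obtain f where f: "\<And>v. v \<in> ?V \<Longrightarrow> lowest S {f v} v" by metis
  have "inj_on f ?V" by (rule inj_onI) (metis f lowest_unique)
  moreover have img: "f ` ?V \<subseteq> S - farthest S center"
  proof (rule image_subsetI)
    fix v assume v: "v \<in> ?V"
    then have low: "lowest S {f v} v" using f by auto
    then have "f v \<in> S" using farthest_subset[of v] by (auto simp: is_arg_min_linorder)
    moreover have "f v \<notin> farthest S center"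
    proof
      \<comment> \<open>The center is feasible for such a site and is the global minimum, so it
        would coincide with \<open>v\<close>.\<close>
      assume "f v \<in> farthest S center"
      then have "lowest S {f v} center" by (intro lowest_center_of) auto
      then show False using lowest_unique[OF low] v by auto
    qed
    ultimately show "f v \<in> S - farthest S center" by simp
  qed
  ultimately have "finite ?V" "card ?V \<le> card (S - farthest S center)"
    using fin inj_on_finite[of f ?V] card_inj_on_le[of f ?V] by blast+
  moreover have "card (S - farthest S center) + card (farthest S center) = card S"
    using card_Diff_subset[OF finite_farthest farthest_subset] card_mono[OF fin farthest_subset] by simp
  ultimately show "finite (triple_points S)"
    "card ?V + card (farthest S center) \<le> card S" by auto
qed

lemma card_adjacent_pairs:
  "finite (adjacent_pairs S)"
  "card (adjacent_pairs S) \<le> (card (farthest S center) choose 2) + 2 * card (triple_points S - {center})"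
proof -
  let ?V = "triple_points S - {center}"
  \<comment> \<open>The pairs charged to \<open>v\<close>: each adjacent pair is charged to the
    point where its minimum is attained.\<close>
  define Q where "Q v = {e. card e = 2 \<and> lowest S e v}" for v
  have sub: "Q v \<subseteq> {e. e \<subseteq> farthest S v \<and> card e = 2}" for v
    by (auto simp: Q_def is_arg_min_linorder)
  have finB: "finite {e. e \<subseteq> farthest S v \<and> card e = 2}" for v
    using finite_farthest by (auto intro: finite_subset[of _ "Pow (farthest S v)"])
  have finQ: "finite (Q v)" for v using finite_subset[OF sub finB] .
  have Q2: "card (Q v) \<le> 2" if v: "v \<in> ?V" for v
  proof -
    obtain e where "e \<subseteq> farthest S v" "card e = 2" "\<not> lowest S e v"
      using triple_point_pair_not_lowest v by blast
    then have "Q v \<subset> {e. e \<subseteq> farthest S v \<and> card e = 2}" using sub[of v] by (auto simp: Q_def)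
    then have "card (Q v) < card (farthest S v) choose 2"
      using psubset_card_mono[OF finB] by (simp add: n_subsets[OF finite_farthest])
    also have "\<dots> = 3" using v by (simp add: triple_points_def choose_two)
    finally show ?thesis by simp
  qed
  have cover: "adjacent_pairs S \<subseteq> Q center \<union> (\<Union>v\<in>?V. Q v)"
  proof
    fix e assume "e \<in> adjacent_pairs S"
    then obtain y where e: "card e = 2" "e \<subseteq> farthest S y" by (auto simp: adjacent_pairs_def)
    then obtain v where "lowest S e v" using lowest_exists by blast
    then show "e \<in> Q center \<union> (\<Union>v\<in>?V. Q v)" using e lowest_pair[of e v] by (auto simp: Q_def)
  qed
  have finV: "finite ?V" using card_triple_points(1) by simp
  have finC: "finite (Q center \<union> (\<Union>v\<in>?V. Q v))" using finQ finV by auto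
  then show "finite (adjacent_pairs S)" by (rule finite_subset[OF cover])
  have "card (adjacent_pairs S) \<le> card (Q center \<union> (\<Union>v\<in>?V. Q v))" by (rule card_mono[OF finC cover])
  also have "\<dots> \<le> card (Q center) + card (\<Union>v\<in>?V. Q v)" by (rule card_Un_le)
  also have "card (Q center) \<le> card (farthest S center) choose 2"
    using card_mono[OF finB sub, of center] by (simp add: n_subsets[OF finite_farthest])
  also have "card (\<Union>v\<in>?V. Q v) \<le> (\<Sum>v\<in>?V. card (Q v))" by (rule card_UN_le[OF finV])
  also have "\<dots> \<le> (\<Sum>v\<in>?V. 2)" by (rule sum_mono) (rule Q2)
  finally show "card (adjacent_pairs S) \<le> (card (farthest S center) choose 2) + 2 * card ?V" by simp
qed

text \<open>Let \<open>n\<close> be the number of sites. Two farthest sites at the center give at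
  most \<open>3 * (n - 2) + 1\<close>; three give at most \<open>3 * (n - 3) + 3 + 1\<close>, the
  last 1 being the center itself. Both equal \<open>3 * n - 5\<close>.\<close>

lemma card_triple_points_plus_adjacent_pairs:
  "card (triple_points S) + card (adjacent_pairs S) \<le> 3 * card S - 5"
proof -
  consider "card (farthest S center) = 2" | "card (farthest S center) = 3"
    using card_farthest_center card_farthest_le[of center] by linarith
  then show ?thesis
  proof cases
    case 1
    then have "center \<notin> triple_points S" by (simp add: triple_points_def)
    then show ?thesis using 1 card_triple_points(2) card_adjacent_pairs(2) by (simp add: choose_two)
  next
    case 2
    then have "center \<in> triple_points S" by (simp add: triple_points_def)
    then have "card (triple_points S) = Suc (card (triple_points S - {center}))"
      using card_triple_points(1) by (metis card.remove)
    then show ?thesis using 2 card_triple_points(2) card_adjacent_pairs(2) by (simp add: choose_two)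
  qed
qed

section \<open>Edges and nodes in terms of farthest sites\<close>

lemma frontier_FV_farthest:
  assumes "x \<in> S" "y \<in> frontier (FV S x)"
  shows "x \<in> farthest S y"
proof -
  have "closed (\<Inter>s\<in>S. {y. norm (y - s) \<le> norm (y - x)})"
    by (auto intro!: closed_INT closed_Collect_le continuous_intros)
  moreover have "FV S x \<subseteq> (\<Inter>s\<in>S. {y. norm (y - s) \<le> norm (y - x)})"
  proof (clarify, goal_cases)
    case (1 y s)
    then show ?case by (cases "s = x") (auto simp: FV_def intro: less_imp_le)
  qed
  ultimately have "closure (FV S x) \<subseteq> (\<Inter>s\<in>S. {y. norm (y - s) \<le> norm (y - x)})"
    by (intro closure_minimal)
  then show ?thesis using assms by (auto simp: farthest_iff frontier_def)
qed

text \<open>Writing \<open>E\<close> as an intersection over \<open>e\<close> makes it a function of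
  the unordered pair, so that edges can be counted as an image of
  \<open>adjacent_pairs S\<close>.\<close>

lemma edge_adjacent_pair:
  assumes "E \<in> edges S"
  shows "\<exists>e\<in>adjacent_pairs S. E = (\<Inter>x\<in>e. frontier (FV S x)) \<and> (\<forall>y\<in>E. e \<subseteq> farthest S y)"
proof -
  obtain x z where xz: "x \<in> S" "z \<in> S" "x \<noteq> z" "E = frontier (FV S x) \<inter> frontier (FV S z)" "E \<noteq> {}"
    using assms by (auto simp: edges_def)
  then have sub: "{x, z} \<subseteq> farthest S y" if "y \<in> E" for y
    using that frontier_FV_farthest by auto
  moreover from this have "{x, z} \<in> adjacent_pairs S"
    using xz by (auto simp: adjacent_pairs_def card_2_iff)
  ultimately show ?thesis using xz by (intro bexI[of _ "{x, z}"]) auto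
qed

lemma finite_edges: "finite (edges S)"
  and card_edges: "card (edges S) \<le> card (adjacent_pairs S)"
proof -
  have "edges S \<subseteq> (\<lambda>e. \<Inter>x\<in>e. frontier (FV S x)) ` adjacent_pairs S"
    using edge_adjacent_pair by blast
  then show "finite (edges S)" "card (edges S) \<le> card (adjacent_pairs S)"
    using card_adjacent_pairs(1) by (auto intro: finite_surj surj_card_le)
qed

text \<open>Different edges have different pairs, which together provide three farthest sites. A
  segment of \<open>E\<close> through \<open>y\<close> would have a direction orthogonal to two
  independent sides of their triangle.\<close>

lemma edges_meet:
  assumes "E \<in> edges S" "F \<in> edges S" "E \<noteq> F" "y \<in> E" "y \<in> F"
  shows "y \<in> triple_points S" "y extreme_point_of E"
proof -
  obtain e where e: "e \<in> adjacent_pairs S"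
    and E: "E = (\<Inter>x\<in>e. frontier (FV S x)) \<and> (\<forall>y\<in>E. e \<subseteq> farthest S y)"
    using edge_adjacent_pair[OF assms(1)] by (rule bexE)
  obtain f where f: "f \<in> adjacent_pairs S"
    and F: "F = (\<Inter>x\<in>f. frontier (FV S x)) \<and> (\<forall>y\<in>F. f \<subseteq> farthest S y)"
    using edge_adjacent_pair[OF assms(2)] by (rule bexE)
  note far_e = bspec[OF conjunct2[OF E]] and far_f = bspec[OF conjunct2[OF F]]
  have ce: "card e = 2" "card f = 2" using e f by (simp_all add: adjacent_pairs_def)
  have "e \<noteq> f" using conjunct1[OF E] conjunct1[OF F] assms(3) by metis
  moreover have fine: "finite e" using ce card.infinite[of e] by fastforce
  ultimately have "\<not> f \<subseteq> e" using ce card_subset_eq[of e f] by auto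
  then obtain c where c: "c \<in> f" "c \<notin> e" by auto
  have ef: "insert c e \<subseteq> farthest S y" using far_e[OF assms(4)] far_f[OF assms(5)] c by blast
  have "card (insert c e) = 3" using ce c fine by simp
  then have "card (farthest S y) = 3"
    using card_mono[OF finite_farthest ef] card_farthest_le[of y] by simp
  then show "y \<in> triple_points S" by (simp add: triple_points_def)
  obtain a b where ab: "e = {a, b}" "a \<noteq> b" using ce by (auto simp: card_2_iff)
  have ca: "c \<noteq> a" "c \<noteq> b" using c ab by auto
  have far: "{a, b, c} \<subseteq> farthest S y" using ef ab by auto
  have rel: "(p - y) \<bullet> (a - y) = (p - y) \<bullet> (b - y)" "(p - y) \<bullet> (a - y) \<le> (p - y) \<bullet> (c - y)"
    if "p \<in> E" for p
  proof -
    have "{a, b} \<subseteq> farthest S p" using far_e[OF that] ab by simp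
    then have "norm (p - a) = norm (p - b)" "norm (p - c) \<le> norm (p - a)"
      using farthestD[of a p] farthestD[of b p] far farthest_subset[of y] norm_le_max_dist[of c p] by auto
    then have "(norm (p - a))\<^sup>2 = (norm (p - b))\<^sup>2" "(norm (p - c))\<^sup>2 \<le> (norm (p - a))\<^sup>2"
      by (auto simp: power_mono)
    moreover have "norm (y - a) = norm (y - b)" "norm (y - c) = norm (y - a)"
      using far farthestD[of a y] farthestD[of b y] farthestD[of c y] by auto
    ultimately show "(p - y) \<bullet> (a - y) = (p - y) \<bullet> (b - y)" "(p - y) \<bullet> (a - y) \<le> (p - y) \<bullet> (c - y)"
      using norm_diff_sq[of p a y] norm_diff_sq[of p b y] norm_diff_sq[of p c y] by simp_all
  qed
  show "y extreme_point_of E"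
    unfolding extreme_point_of_def
  proof (intro conjI ballI notI)
    fix p q assume pq: "p \<in> E" "q \<in> E" and y: "y \<in> open_segment p q"
    then obtain t where t: "0 < t" "t < 1" "y = (1 - t) *\<^sub>R p + t *\<^sub>R q" and "p \<noteq> q"
      by (auto simp: in_segment)
    have yp: "p - y = t *\<^sub>R (p - q)" and yq: "q - y = (1 - t) *\<^sub>R (- (p - q))"
      unfolding t(3) by (simp_all add: algebra_simps)
    define d where "d = p - q"
    have d0: "d \<noteq> 0" using \<open>p \<noteq> q\<close> by (simp add: d_def)
    have "d \<bullet> (a - y) = d \<bullet> (b - y)" "d \<bullet> (a - y) \<le> d \<bullet> (c - y)"
      using rel[OF pq(1)] t(1) unfolding yp d_def[symmetric] by simp_all
    \<comment> \<open>\<open>p\<close> and \<open>q\<close> lie on opposite sides of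
      \<open>y\<close>, so the inequality for \<open>q\<close> is the reverse of the one for
      \<open>p\<close>.\<close>
    moreover have "d \<bullet> (c - y) \<le> d \<bullet> (a - y)"
      using rel(2)[OF pq(2)] t(2) unfolding yq d_def[symmetric] by simp
    ultimately have db: "d \<bullet> (b - a) = 0" and dc: "d \<bullet> (c - a) = 0"
      by (simp_all add: inner_diff_right)
    have "cross2 ((b - y) - (a - y)) ((c - y) - (a - y)) \<noteq> 0"
      using ab ca far farthestD[of a y] farthestD[of b y] farthestD[of c y]
      by (intro circle_not_collinear) (auto simp: norm_minus_commute)
    then have cr: "cross2 (b - a) (c - a) \<noteq> 0" by simp
    \<comment> \<open>Cramer's rule: \<open>d\<close> is orthogonal to both \<open>b - a\<close> and
      \<open>c - a\<close>, whose determinant is nonzero.\<close>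
    have "d $ i * cross2 (b - a) (c - a) = 0" for i
    proof -
      have "d $ 1 * cross2 (b - a) (c - a) = (d \<bullet> (b - a)) * (c - a) $ 2 - (d \<bullet> (c - a)) * (b - a) $ 2"
        "d $ 2 * cross2 (b - a) (c - a) = (d \<bullet> (c - a)) * (b - a) $ 1 - (d \<bullet> (b - a)) * (c - a) $ 1"
        by (simp_all add: cross2_def inner_vec_def sum_2 algebra_simps)
      then show ?thesis using db dc exhaust_2[of i] by auto
    qed
    then have "d = 0" using cr by (simp add: vec_eq_iff)
    then show False using d0 by simp
  qed (rule assms)
qed

lemma finite_nodes: "finite (nodes S)"
  and card_nodes: "card (nodes S) \<le> Suc (card (triple_points S))"
proof -
  have sub: "nodes S \<subseteq> insert None (Some ` triple_points S)"
  proof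
    fix v assume "v \<in> nodes S"
    then consider "v = None" | y E F where "v = Some y" "E \<in> edges S" "F \<in> edges S" "E \<noteq> F" "y \<in> E" "y \<in> F"
      unfolding nodes_def by blast
    then show "v \<in> insert None (Some ` triple_points S)"
      by cases (simp_all add: edges_meet(1))
  qed
  have fin': "finite (insert None (Some ` triple_points S))" using card_triple_points(1) by simp
  show "finite (nodes S)" by (rule finite_subset[OF sub fin'])
  have "card (nodes S) \<le> card (insert None (Some ` triple_points S))" by (rule card_mono[OF fin' sub])
  also have "\<dots> = Suc (card (triple_points S))"
    using card_triple_points(1) by (simp add: card_image)
  finally show "card (nodes S) \<le> Suc (card (triple_points S))" .
qed

section \<open>Disjointness of the regions and the final count\<close>

lemma edge_interiors_disjoint:
  assumes "E \<in> edges S" "F \<in> edges S" "E \<noteq> F"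
  shows "edge_interior E \<inter> edge_interior F = {}"
  using edges_meet(2)[OF assms] by (auto simp: edge_interior_def)

text \<open>A finite node lies on two edges, at least one of which differs from \<open>E\<close>;
  hence it is an extreme point of \<open>E\<close>.\<close>

lemma node_not_in_edge_interior:
  assumes "v \<in> nodes S" "E \<in> edges S"
  shows "v \<notin> Some ` edge_interior E"
proof
  assume "v \<in> Some ` edge_interior E"
  then obtain y where y: "v = Some y" "y \<in> E" "\<not> y extreme_point_of E" by (auto simp: edge_interior_def)
  then obtain F G where FG: "F \<in> edges S" "G \<in> edges S" "F \<noteq> G" "y \<in> F" "y \<in> G"
    using assms(1) unfolding nodes_def by blast
  show False
    using edges_meet(2)[OF assms(2) FG(1) _ y(2) FG(4)] edges_meet(2)[OF assms(2) FG(2) _ y(2) FG(5)] FG(3) y(3)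
    by (cases "E = F") auto
qed

lemma disjoint_plane_division: "disjoint (plane_division S)"
proof -
  \<comment> \<open>The sets of values of \<phi> whose preimages are the candidate regions; their
    disjointness passes to the preimages.\<close>
  define \<Q> where "\<Q> = (\<lambda>v. {v}) ` nodes S \<union> (\<lambda>E. Some ` edge_interior E) ` edges S"
  have div: "plane_division S = \<phi>_preimage S ` \<Q> - {{}}"
    unfolding plane_division_def \<Q>_def by blast
  have dj: "P \<inter> Q = {}" if PQ: "P \<in> \<Q>" "Q \<in> \<Q>" "P \<noteq> Q" for P Q
  proof -
    have part: "(\<exists>v\<in>nodes S. X = {v}) \<or> (\<exists>E\<in>edges S. X = Some ` edge_interior E)" if "X \<in> \<Q>" for X
      using that unfolding \<Q>_def by (elim UnE imageE) auto
    show ?thesis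
      using part[OF PQ(1)] part[OF PQ(2)]
    proof (elim disjE bexE)
      fix v w assume "P = {v}" "Q = {w}"
      then show ?thesis using PQ(3) by simp
    next
      fix v E assume "v \<in> nodes S" "E \<in> edges S" "P = {v}" "Q = Some ` edge_interior E"
      then show ?thesis using node_not_in_edge_interior by simp
    next
      fix v E assume "v \<in> nodes S" "E \<in> edges S" "Q = {v}" "P = Some ` edge_interior E"
      then show ?thesis using node_not_in_edge_interior by simp
    next
      fix E F assume EF: "E \<in> edges S" "F \<in> edges S"
        and P: "P = Some ` edge_interior E" and Q: "Q = Some ` edge_interior F"
      have "E \<noteq> F" using P Q PQ(3) by metis
      then have "edge_interior E \<inter> edge_interior F = {}" using EF by (intro edge_interiors_disjoint)
      then show ?thesis unfolding P Q by blast
    qed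
  qed
  show ?thesis unfolding pairwise_def disjnt_def
  proof (intro ballI impI)
    fix X Y assume "X \<in> plane_division S" "Y \<in> plane_division S" "X \<noteq> Y"
    then obtain P Q where "P \<in> \<Q>" "Q \<in> \<Q>" "X = \<phi>_preimage S P" "Y = \<phi>_preimage S Q" "P \<noteq> Q"
      unfolding div by blast
    then show "X \<inter> Y = {}" using dj[of P Q] by (auto simp: \<phi>_preimage_def)
  qed
qed

lemma finite_plane_division: "finite (plane_division S)"
  and card_plane_division: "card (plane_division S) \<le> 3 * card S - 4"
proof -
  let ?N = "(\<lambda>v. \<phi>_preimage S {v}) ` nodes S"
  let ?E = "(\<lambda>E. \<phi>_preimage S (Some ` edge_interior E)) ` edges S"
  have sub: "plane_division S \<subseteq> ?N \<union> ?E" unfolding plane_division_def by blast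
  have fin': "finite (?N \<union> ?E)" using finite_nodes finite_edges by simp
  show "finite (plane_division S)" by (rule finite_subset[OF sub fin'])
  have "card (plane_division S) \<le> card (?N \<union> ?E)" by (rule card_mono[OF fin' sub])
  also have "\<dots> \<le> card ?N + card ?E" by (rule card_Un_le)
  also have "\<dots> \<le> card (nodes S) + card (edges S)"
    using finite_nodes finite_edges by (intro add_mono card_image_le)
  \<comment> \<open>The node at infinity turns \<open>3 * card S - 5\<close> into
    \<open>3 * card S - 4\<close>; \<open>card_ge\<close> keeps the natural subtraction from being
    truncated.\<close>
  also have "\<dots> \<le> 3 * card S - 4"
    using card_nodes card_edges card_triple_points_plus_adjacent_pairs card_ge by linarith
  finally show "card (plane_division S) \<le> 3 * card S - 4" .
qed

end

theorem theorem5p3: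
  fixes S :: "point set" and m :: nat
  assumes "finite S"
    and "card S \<ge> 2"
    and "general_position S"
    and "S \<subseteq> hull_vertices S"
    and "m = card (hull_vertices S)"
  shows "finite (plane_division S) \<and> disjoint (plane_division S) \<and> card (plane_division S) \<le> 3 * m - 4"
proof -
  interpret planar_sites S using assms by unfold_locales
  have "hull_vertices S \<subseteq> S"
    unfolding hull_vertices_def using extreme_point_of_convex_hull by blast
  then have "m = card S" using assms by (simp add: subset_antisym)
  then show ?thesis
    using finite_plane_division disjoint_plane_division card_plane_division by simp
qed

end
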